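(* Let $\Gamma$ be a commutative group and $T=(T,u)$ a commutative ternary $\Gamma$-semiring which is idempotent, i.e. $x+x=x$ for all $x\in T$. Then for every open $U\subseteq\mathrm{Spec}_\Gamma(T)$ and every fixed $\gamma\in\Gamma$, the triadic bracket $[s_1,s_2,s_3]:=\{s_1,s_2,s_3\}_{\gamma,U}=s_1\cdot s_2\cdot s_3\cdot u_\gamma$ on $\mathcal{O}_T(U)$ satisfies the idempotent Filippov identity: for all $x_1,x_2,y_1,y_2,y_3\in\mathcal{O}_T(U)$, $$[x_1,x_2,[y_1,y_2,y_3]]=[[x_1,x_2,y_1],y_2,y_3]+[y_1,[x_1,x_2,y_2],y_3]+[y_1,y_2,[x_1,x_2,y_3]].$$
   Context: A commutative semiring is a tuple $(T,+,\cdot,0,1)$ with $(T,+,0)$ and $(T,\cdot,1)$ commutative monoids, multiplication distributing over addition, and $0\cdot x=x\cdot 0=0$. A commutative ternary $\Gamma$-semiring $(T,u)$ is a commutative semiring $T$ with a group homomorphism $u:\Gamma\to T^\times$, $\gamma\mapsto u_\gamma$, together with the operations $\{a\,b\,c\}_\gamma:=a b c u_\gamma$. A $\Gamma$-ideal of $T$ is a subset $I$ which is a submonoid of $(T,+,0)$ and satisfies $\{a\,b\,c\}_\gamma\in I$ for all $a\in I$, $b,c\in T$, $\gamma\in\Gamma$. A proper $\Gamma$-ideal $P$ is prime if $\{a\,b\,c\}_\gamma\in P$ implies $a\in P$ or $b\in P$ or $c\in P$, for all $a,b,c\in T$, $\gamma\in\Gamma$. $\mathrm{Spec}_\Gamma(T)$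 is the set of prime $\Gamma$-ideals with the topology whose closed sets are $V(I)=\{P\mid I\subseteq P\}$ for $\Gamma$-ideals $I$; the principal opens $D_\Gamma(f)=\{P\mid f\notin P\}$ form a basis. For $f\in T$, $T_f$ is the localization of the semiring $T$ at $S_f=\{1,f,f^2,\dots\}$: fractions $\frac as$ with $\frac as=\frac bt$ iff $wat=wbs$ for some $w\in S_f$, and the usual operations. The structure sheaf $\mathcal{O}_T$ is the unique sheaf of semirings on $\mathrm{Spec}_\Gamma(T)$ extending $\mathcal{O}_T(D_\Gamma(f))=T_f$, with restriction $T_f\to T_g$ for $D_\Gamma(g)\subseteq D_\Gamma(f)$ the unique semiring homomorphism compatible with the canonical maps from $T$. In the triadic bracket on $\mathcal{O}_T(U)$, multiplication is that of the semiring $\mathcal{O}_T(U)$ and $u_\gamma$ denotes the unit section it induces. The idempotent Filippov identity is defined for a trilinear operation $[\cdot,\cdot,\cdot]:A^3\to A$ on an idempotent commutative monoid $(A,+)$ by the displayed formula; here $A=\mathcal{O}_T(U)$. *)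

theory Defs
  imports "HOL-Algebra.Ring" "HOL-Analysis.Abstract_Topology"
begin

section \<open>Commutative semirings\<close>

locale comm_semiring = semiring + comm_monoid R

text \<open>The set \<open>ring_hom\<close> does not require preservation of zero, which is not automatic for semirings.\<close>

definition semiring_hom :: "('a, 'm) ring_scheme \<Rightarrow> ('b, 'n) ring_scheme \<Rightarrow> ('a \<Rightarrow> 'b) set" where
  "semiring_hom R S = {h \<in> ring_hom R S. h \<zero>\<^bsub>R\<^esub> = \<zero>\<^bsub>S\<^esub>}"

definition semiring_iso :: "('a, 'm) ring_scheme \<Rightarrow> ('b, 'n) ring_scheme \<Rightarrow> ('a \<Rightarrow> 'b) set" where
  "semiring_iso R S = {h \<in> semiring_hom R S. bij_betw h (carrier R) (carrier S)}"

definition idempotent_semiring :: "('a, 'm) ring_scheme \<Rightarrow> bool" where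
  "idempotent_semiring R \<longleftrightarrow> (\<forall>x\<in>carrier R. x \<oplus>\<^bsub>R\<^esub> x = x)"

definition idempotent_Filippov_identity ::
    "('a, 'm) ring_scheme \<Rightarrow> ('a \<Rightarrow> 'a \<Rightarrow> 'a \<Rightarrow> 'a) \<Rightarrow> bool" where
  "idempotent_Filippov_identity A br \<longleftrightarrow>
     (\<forall>x1\<in>carrier A. \<forall>x2\<in>carrier A. \<forall>y1\<in>carrier A. \<forall>y2\<in>carrier A. \<forall>y3\<in>carrier A.
        br x1 x2 (br y1 y2 y3) =
        br (br x1 x2 y1) y2 y3 \<oplus>\<^bsub>A\<^esub> br y1 (br x1 x2 y2) y3 \<oplus>\<^bsub>A\<^esub> br y1 y2 (br x1 x2 y3))"


section \<open>Localization\<close>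

definition frac_rel :: "('a, 'm) ring_scheme \<Rightarrow> 'a set \<Rightarrow> (('a \<times> 'a) \<times> ('a \<times> 'a)) set" where
  "frac_rel T S = {((a, s), (b, t)). a \<in> carrier T \<and> s \<in> S \<and> b \<in> carrier T \<and> t \<in> S \<and>
     (\<exists>w\<in>S. w \<otimes>\<^bsub>T\<^esub> a \<otimes>\<^bsub>T\<^esub> t = w \<otimes>\<^bsub>T\<^esub> b \<otimes>\<^bsub>T\<^esub> s)}"

definition fraction :: "('a, 'm) ring_scheme \<Rightarrow> 'a set \<Rightarrow> 'a \<Rightarrow> 'a \<Rightarrow> ('a \<times> 'a) set" where
  "fraction T S a s = frac_rel T S `` {(a, s)}"

definition localization :: "('a, 'm) ring_scheme \<Rightarrow> 'a set \<Rightarrow> ('a \<times> 'a) set ring" where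
  "localization T S =
     \<lparr>carrier = (carrier T \<times> S) // frac_rel T S,
      monoid.mult = (\<lambda>X Y. \<Union>(a, s)\<in>X. \<Union>(b, t)\<in>Y. fraction T S (a \<otimes>\<^bsub>T\<^esub> b) (s \<otimes>\<^bsub>T\<^esub> t)),
      one = fraction T S \<one>\<^bsub>T\<^esub> \<one>\<^bsub>T\<^esub>,
      zero = fraction T S \<zero>\<^bsub>T\<^esub> \<one>\<^bsub>T\<^esub>,
      add = (\<lambda>X Y. \<Union>(a, s)\<in>X. \<Union>(b, t)\<in>Y.
               fraction T S (a \<otimes>\<^bsub>T\<^esub> t \<oplus>\<^bsub>T\<^esub> b \<otimes>\<^bsub>T\<^esub> s) (s \<otimes>\<^bsub>T\<^esub> t))\<rparr>"

definition powers :: "('a, 'm) ring_scheme \<Rightarrow> 'a \<Rightarrow> 'a set" where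
  "powers T f = range (\<lambda>n::nat. f [^]\<^bsub>T\<^esub> n)"

definition loc_at :: "('a, 'm) ring_scheme \<Rightarrow> 'a \<Rightarrow> ('a \<times> 'a) set ring" where
  "loc_at T f = localization T (powers T f)"

definition to_loc_at :: "('a, 'm) ring_scheme \<Rightarrow> 'a \<Rightarrow> 'a \<Rightarrow> ('a \<times> 'a) set" where
  "to_loc_at T f a = fraction T (powers T f) a \<one>\<^bsub>T\<^esub>"

text \<open>The unique semiring homomorphism \<open>T\<^sub>f \<rightarrow> T\<^sub>g\<close> under \<open>T\<close>, made unique as a
  HOL function by extensionality; existence and uniqueness for \<open>D(g) \<subseteq> D(f)\<close> are shown below.\<close>

definition loc_restriction ::
    "('a, 'm) ring_scheme \<Rightarrow> 'a \<Rightarrow> 'a \<Rightarrow> ('a \<times> 'a) set \<Rightarrow> ('a \<times> 'a) set" where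
  "loc_restriction T f g =
     (THE h. h \<in> semiring_hom (loc_at T f) (loc_at T g) \<and> h \<in> extensional (carrier (loc_at T f)) \<and>
        (\<forall>a\<in>carrier T. h (to_loc_at T f a) = to_loc_at T g a))"


section \<open>Commutative ternary \<open>\<Gamma>\<close>-semirings and their spectra\<close>

locale ternary_gamma_semiring = comm_semiring T + \<Gamma>: comm_group \<Gamma>
  for T :: "('a, 'm) ring_scheme" (structure) and \<Gamma> :: "('g, 'n) monoid_scheme" +
  fixes u :: "'g \<Rightarrow> 'a"
  assumes u_hom: "u \<in> hom \<Gamma> (units_of T)"

definition triadic :: "('a, 'm) ring_scheme \<Rightarrow> 'a \<Rightarrow> 'a \<Rightarrow> 'a \<Rightarrow> 'a \<Rightarrow> 'a" where
  "triadic R v a b c = a \<otimes>\<^bsub>R\<^esub> b \<otimes>\<^bsub>R\<^esub> c \<otimes>\<^bsub>R\<^esub> v"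

definition gamma_ideal ::
    "('a, 'm) ring_scheme \<Rightarrow> ('g, 'n) monoid_scheme \<Rightarrow> ('g \<Rightarrow> 'a) \<Rightarrow> 'a set \<Rightarrow> bool" where
  "gamma_ideal T \<Gamma> u I \<longleftrightarrow> submonoid I (add_monoid T) \<and>
     (\<forall>a\<in>I. \<forall>b\<in>carrier T. \<forall>c\<in>carrier T. \<forall>\<gamma>\<in>carrier \<Gamma>. triadic T (u \<gamma>) a b c \<in> I)"

definition prime_gamma_ideal ::
    "('a, 'm) ring_scheme \<Rightarrow> ('g, 'n) monoid_scheme \<Rightarrow> ('g \<Rightarrow> 'a) \<Rightarrow> 'a set \<Rightarrow> bool" where
  "prime_gamma_ideal T \<Gamma> u P \<longleftrightarrow> gamma_ideal T \<Gamma> u P \<and> P \<noteq> carrier T \<and>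
     (\<forall>a\<in>carrier T. \<forall>b\<in>carrier T. \<forall>c\<in>carrier T. \<forall>\<gamma>\<in>carrier \<Gamma>.
        triadic T (u \<gamma>) a b c \<in> P \<longrightarrow> a \<in> P \<or> b \<in> P \<or> c \<in> P)"

definition Spec ::
    "('a, 'm) ring_scheme \<Rightarrow> ('g, 'n) monoid_scheme \<Rightarrow> ('g \<Rightarrow> 'a) \<Rightarrow> 'a set set" where
  "Spec T \<Gamma> u = {P. prime_gamma_ideal T \<Gamma> u P}"

definition vanishing ::
    "('a, 'm) ring_scheme \<Rightarrow> ('g, 'n) monoid_scheme \<Rightarrow> ('g \<Rightarrow> 'a) \<Rightarrow> 'a set \<Rightarrow> 'a set set" where
  "vanishing T \<Gamma> u I = {P \<in> Spec T \<Gamma> u. I \<subseteq> P}"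

definition spec_topology ::
    "('a, 'm) ring_scheme \<Rightarrow> ('g, 'n) monoid_scheme \<Rightarrow> ('g \<Rightarrow> 'a) \<Rightarrow> 'a set topology" where
  "spec_topology T \<Gamma> u =
     topology (\<lambda>U. \<exists>I. gamma_ideal T \<Gamma> u I \<and> U = Spec T \<Gamma> u - vanishing T \<Gamma> u I)"

definition principal_open ::
    "('a, 'm) ring_scheme \<Rightarrow> ('g, 'n) monoid_scheme \<Rightarrow> ('g \<Rightarrow> 'a) \<Rightarrow> 'a \<Rightarrow> 'a set set" where
  "principal_open T \<Gamma> u f = {P \<in> Spec T \<Gamma> u. f \<notin> P}"


section \<open>Sheaves of semirings and the structure sheaf\<close>

text \<open>\<open>\<rho> U V\<close> is the restriction map from \<open>F U\<close> to \<open>F V\<close>.\<close>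

locale semiring_presheaf =
  fixes X :: "'p topology"
    and F :: "'p set \<Rightarrow> 'b ring"
    and \<rho> :: "'p set \<Rightarrow> 'p set \<Rightarrow> 'b \<Rightarrow> 'b"
  assumes sections: "openin X U \<Longrightarrow> comm_semiring (F U)"
    and restr_hom: "\<lbrakk>openin X U; openin X V; V \<subseteq> U\<rbrakk> \<Longrightarrow> \<rho> U V \<in> semiring_hom (F U) (F V)"
    and restr_id: "\<lbrakk>openin X U; s \<in> carrier (F U)\<rbrakk> \<Longrightarrow> \<rho> U U s = s"
    and restr_comp: "\<lbrakk>openin X U; openin X V; openin X W; W \<subseteq> V; V \<subseteq> U; s \<in> carrier (F U)\<rbrakk>
      \<Longrightarrow> \<rho> V W (\<rho> U V s) = \<rho> U W s"

locale semiring_sheaf = semiring_presheaf +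
  assumes locality: "\<lbrakk>\<And>V. V \<in> \<V> \<Longrightarrow> openin X V; s \<in> carrier (F (\<Union>\<V>)); t \<in> carrier (F (\<Union>\<V>));
      \<And>V. V \<in> \<V> \<Longrightarrow> \<rho> (\<Union>\<V>) V s = \<rho> (\<Union>\<V>) V t\<rbrakk> \<Longrightarrow> s = t"
    and gluing: "\<lbrakk>\<And>V. V \<in> \<V> \<Longrightarrow> openin X V; \<And>V. V \<in> \<V> \<Longrightarrow> \<sigma> V \<in> carrier (F V);
      \<And>V W. \<lbrakk>V \<in> \<V>; W \<in> \<V>\<rbrakk> \<Longrightarrow> \<rho> V (V \<inter> W) (\<sigma> V) = \<rho> W (V \<inter> W) (\<sigma> W)\<rbrakk>
      \<Longrightarrow> \<exists>s\<in>carrier (F (\<Union>\<V>)). \<forall>V\<in>\<V>. \<rho> (\<Union>\<V>) V s = \<sigma> V"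

text \<open>The structure sheaf is determined up to unique isomorphism as a sheaf \<open>F\<close> together with
  identifications \<open>\<phi> f\<close> of \<open>F (D(f))\<close> with \<open>T\<^sub>f\<close> that turn restriction into the canonical maps
  \<open>T\<^sub>f \<rightarrow> T\<^sub>g\<close>. Different \<open>f\<close> may have the same \<open>D(f)\<close> but literally different \<open>T\<^sub>f\<close>, so the
  identifications have to be part of the data.\<close>

locale structure_sheaf =
  ternary_gamma_semiring T \<Gamma> u + semiring_sheaf "spec_topology T \<Gamma> u" F \<rho>
  for T :: "('a, 'm) ring_scheme" (structure) and \<Gamma> :: "('g, 'n) monoid_scheme"
    and u :: "'g \<Rightarrow> 'a" and F :: "'a set set \<Rightarrow> 'b ring"
    and \<rho> :: "'a set set \<Rightarrow> 'a set set \<Rightarrow> 'b \<Rightarrow> 'b" +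
  fixes \<phi> :: "'a \<Rightarrow> 'b \<Rightarrow> ('a \<times> 'a) set"
  assumes principal_iso: "f \<in> carrier T \<Longrightarrow>
      \<phi> f \<in> semiring_iso (F (principal_open T \<Gamma> u f)) (loc_at T f)"
    and principal_restr: "\<lbrakk>f \<in> carrier T; g \<in> carrier T;
      principal_open T \<Gamma> u g \<subseteq> principal_open T \<Gamma> u f; s \<in> carrier (F (principal_open T \<Gamma> u f))\<rbrakk>
      \<Longrightarrow> \<phi> g (\<rho> (principal_open T \<Gamma> u f) (principal_open T \<Gamma> u g) s) =
          loc_restriction T f g (\<phi> f s)"

text \<open>The section over \<open>U\<close> induced by \<open>a \<in> T\<close>: its image under
  \<open>T \<rightarrow> T\<^sub>1 \<cong> F (D(1)) = F (Spec T) \<rightarrow> F U\<close>.\<close>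

definition induced_section ::
    "('a, 'm) ring_scheme \<Rightarrow> ('g, 'n) monoid_scheme \<Rightarrow> ('g \<Rightarrow> 'a) \<Rightarrow> ('a set set \<Rightarrow> 'b ring) \<Rightarrow>
     ('a set set \<Rightarrow> 'a set set \<Rightarrow> 'b \<Rightarrow> 'b) \<Rightarrow> ('a \<Rightarrow> 'b \<Rightarrow> ('a \<times> 'a) set) \<Rightarrow> 'a set set \<Rightarrow> 'a \<Rightarrow> 'b" where
  "induced_section T \<Gamma> u F \<rho> \<phi> U a =
     \<rho> (Spec T \<Gamma> u) U
       (the_inv_into (carrier (F (Spec T \<Gamma> u))) (\<phi> \<one>\<^bsub>T\<^esub>) (to_loc_at T \<one>\<^bsub>T\<^esub> a))"


section \<open>Well-definedness\<close>

context ternary_gamma_semiring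
begin

lemma u_closed: "\<gamma> \<in> carrier \<Gamma> \<Longrightarrow> u \<gamma> \<in> Units T"
  using u_hom by (auto simp: hom_def units_of_def)

lemma u_carrier: "\<gamma> \<in> carrier \<Gamma> \<Longrightarrow> u \<gamma> \<in> carrier T"
  using u_closed by (auto simp: Units_def)

lemma u_one: "u \<one>\<^bsub>\<Gamma>\<^esub> = \<one>"
proof -
  interpret U: group "units_of T" by (rule units_group)
  interpret group_hom \<Gamma> "units_of T" u
    by unfold_locales (rule u_hom)
  show ?thesis using hom_one by (simp add: units_of_def)
qed

lemma gamma_ideal_iff:
  "gamma_ideal T \<Gamma> u I \<longleftrightarrow> I \<subseteq> carrier T \<and> \<zero> \<in> I \<and> (\<forall>a\<in>I. \<forall>b\<in>I. a \<oplus> b \<in> I) \<and>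
     (\<forall>a\<in>I. \<forall>b\<in>carrier T. a \<otimes> b \<in> I)" (is "?L \<longleftrightarrow> ?R")
proof
  assume L: ?L
  then have *: "I \<subseteq> carrier T" "\<zero> \<in> I" "\<forall>a\<in>I. \<forall>b\<in>I. a \<oplus> b \<in> I"
    by (auto simp: gamma_ideal_def submonoid_def)
  have m: "a \<otimes> b \<in> I" if "a \<in> I" "b \<in> carrier T" for a b
  proof -
    have "triadic T (u \<one>\<^bsub>\<Gamma>\<^esub>) a b \<one> \<in> I"
      using L that by (auto simp: gamma_ideal_def)
    moreover have "a \<in> carrier T" using that *(1) by blast
    ultimately show ?thesis using that by (simp add: triadic_def u_one)
  qed
  show ?R by (intro conjI ballI *(1,2) *(3)[rule_format] m)
next
  assume R: ?R
  have t: "triadic T (u \<gamma>) a b c \<in> I"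
    if "a \<in> I" "b \<in> carrier T" "c \<in> carrier T" "\<gamma> \<in> carrier \<Gamma>" for a b c \<gamma>
    using R that u_carrier[OF that(4)] by (simp add: triadic_def)
  have "submonoid I (add_monoid T)" using R by (simp add: submonoid_def)
  then show ?L unfolding gamma_ideal_def by (intro conjI ballI t)
qed

lemma prime_gamma_ideal_iff:
  "prime_gamma_ideal T \<Gamma> u P \<longleftrightarrow> gamma_ideal T \<Gamma> u P \<and> \<one> \<notin> P \<and>
     (\<forall>a\<in>carrier T. \<forall>b\<in>carrier T. a \<otimes> b \<in> P \<longrightarrow> a \<in> P \<or> b \<in> P)" (is "?L \<longleftrightarrow> ?R")
proof
  assume L: ?L
  then have I: "gamma_ideal T \<Gamma> u P" and ne: "P \<noteq> carrier T" by (auto simp: prime_gamma_ideal_def)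
  have one: "\<one> \<notin> P"
  proof
    assume "\<one> \<in> P"
    then have "\<one> \<otimes> b \<in> P" if "b \<in> carrier T" for b using that I unfolding gamma_ideal_iff by blast
    then show False using I ne by (auto simp: gamma_ideal_iff)
  qed
  have "a \<in> P \<or> b \<in> P" if "a \<in> carrier T" "b \<in> carrier T" "a \<otimes> b \<in> P" for a b
  proof -
    have "triadic T (u \<one>\<^bsub>\<Gamma>\<^esub>) a b \<one> \<in> P" using that by (simp add: triadic_def u_one)
    then show ?thesis
      using L that one \<Gamma>.one_closed one_closed unfolding prime_gamma_ideal_def by blast
  qed
  with I one show ?R by blast
next
  assume R: ?R
  have t: "a \<in> P \<or> b \<in> P \<or> c \<in> P"
    if c: "a \<in> carrier T" "b \<in> carrier T" "c \<in> carrier T" "\<gamma> \<in> carrier \<Gamma>"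
      and t: "triadic T (u \<gamma>) a b c \<in> P" for a b c \<gamma>
  proof -
    have "u \<gamma> \<notin> P"
    proof
      assume "u \<gamma> \<in> P"
      then have "u \<gamma> \<otimes> inv (u \<gamma>) \<in> P"
        using R u_closed[OF c(4)] Units_inv_closed unfolding gamma_ideal_iff by blast
      then show False using R u_closed[OF c(4)] by simp
    qed
    moreover have p: "x \<in> P \<or> y \<in> P" if "x \<otimes> y \<in> P" "x \<in> carrier T" "y \<in> carrier T" for x y
      using R that by blast
    ultimately have "a \<otimes> b \<otimes> c \<in> P"
      using p[of "a \<otimes> b \<otimes> c" "u \<gamma>"] t c u_carrier[OF c(4)] by (simp add: triadic_def)
    then show ?thesis
      using p[of "a \<otimes> b" c] p[of a b] c by auto
  qed
  show ?L unfolding prime_gamma_ideal_def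
  proof (intro conjI ballI impI t)
    show "gamma_ideal T \<Gamma> u P" using R by blast
    show "P \<noteq> carrier T" using R one_closed by blast
  qed
qed

lemma istopology_spec:
  "istopology (\<lambda>U. \<exists>I. gamma_ideal T \<Gamma> u I \<and> U = Spec T \<Gamma> u - vanishing T \<Gamma> u I)"
  unfolding istopology_def
proof (intro conjI allI impI)
  fix U V
  assume "\<exists>I. gamma_ideal T \<Gamma> u I \<and> U = Spec T \<Gamma> u - vanishing T \<Gamma> u I"
    and "\<exists>I. gamma_ideal T \<Gamma> u I \<and> V = Spec T \<Gamma> u - vanishing T \<Gamma> u I"
  then obtain I J where IJ: "gamma_ideal T \<Gamma> u I" "gamma_ideal T \<Gamma> u J"
    and U: "U = Spec T \<Gamma> u - vanishing T \<Gamma> u I" and V: "V = Spec T \<Gamma> u - vanishing T \<Gamma> u J"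
    by blast
  have G: "gamma_ideal T \<Gamma> u (I \<inter> J)" using IJ by (auto simp: gamma_ideal_iff)
  have "I \<subseteq> P \<or> J \<subseteq> P" if "P \<in> Spec T \<Gamma> u" "I \<inter> J \<subseteq> P" for P
  proof (rule ccontr)
    assume "\<not> ?thesis"
    then obtain a b where ab: "a \<in> I" "a \<notin> P" "b \<in> J" "b \<notin> P" by blast
    then have c: "a \<in> carrier T" "b \<in> carrier T" using IJ by (auto simp: gamma_ideal_iff)
    have "a \<otimes> b \<in> I" "b \<otimes> a \<in> J" using ab c IJ by (auto simp: gamma_ideal_iff)
    then have "a \<otimes> b \<in> P" using that m_comm[OF c] by auto
    then show False using that ab c by (auto simp: Spec_def prime_gamma_ideal_iff)
  qed
  then have "U \<inter> V = Spec T \<Gamma> u - vanishing T \<Gamma> u (I \<inter> J)"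
    unfolding U V by (auto simp: vanishing_def)
  with G show "\<exists>I. gamma_ideal T \<Gamma> u I \<and> U \<inter> V = Spec T \<Gamma> u - vanishing T \<Gamma> u I" by blast
next
  fix \<K>
  assume K: "\<forall>K\<in>\<K>. \<exists>I. gamma_ideal T \<Gamma> u I \<and> K = Spec T \<Gamma> u - vanishing T \<Gamma> u I"
  define \<I> where "\<I> = {I. gamma_ideal T \<Gamma> u I \<and> Spec T \<Gamma> u - vanishing T \<Gamma> u I \<in> \<K>}"
  define J where "J = \<Inter>{J. gamma_ideal T \<Gamma> u J \<and> \<Union>\<I> \<subseteq> J}"
  have car: "gamma_ideal T \<Gamma> u (carrier T)" by (auto simp: gamma_ideal_iff)
  have J: "gamma_ideal T \<Gamma> u J"
    unfolding gamma_ideal_iff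
  proof (intro conjI ballI)
    have "\<Union>\<I> \<subseteq> carrier T" unfolding \<I>_def gamma_ideal_iff by blast
    then show "J \<subseteq> carrier T" unfolding J_def using car by blast
    show "\<zero> \<in> J" unfolding J_def gamma_ideal_iff by blast
    show "a \<oplus> b \<in> J" if "a \<in> J" "b \<in> J" for a b
      using that unfolding J_def gamma_ideal_iff by blast
    show "a \<otimes> b \<in> J" if "a \<in> J" "b \<in> carrier T" for a b
      using that unfolding J_def gamma_ideal_iff by blast
  qed
  have KI: "\<Union>\<K> = (\<Union>I\<in>\<I>. Spec T \<Gamma> u - vanishing T \<Gamma> u I)"
    using K unfolding \<I>_def by auto
  have iff: "J \<subseteq> P \<longleftrightarrow> (\<forall>I\<in>\<I>. I \<subseteq> P)" if "P \<in> Spec T \<Gamma> u" for P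
  proof -
    have "gamma_ideal T \<Gamma> u P" using that by (auto simp: Spec_def prime_gamma_ideal_def)
    then show ?thesis unfolding J_def by blast
  qed
  have "\<Union>\<K> = Spec T \<Gamma> u - vanishing T \<Gamma> u J"
    unfolding KI vanishing_def using iff by auto
  with J show "\<exists>I. gamma_ideal T \<Gamma> u I \<and> \<Union>\<K> = Spec T \<Gamma> u - vanishing T \<Gamma> u I" by blast
qed

lemma openin_spec_topology:
  "openin (spec_topology T \<Gamma> u) U \<longleftrightarrow>
     (\<exists>I. gamma_ideal T \<Gamma> u I \<and> U = Spec T \<Gamma> u - vanishing T \<Gamma> u I)"
  unfolding spec_topology_def topology_inverse'[OF istopology_spec] ..

lemma principal_open_one: "principal_open T \<Gamma> u \<one> = Spec T \<Gamma> u"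
proof -
  have "\<one> \<notin> P" if "prime_gamma_ideal T \<Gamma> u P" for P
    using that unfolding prime_gamma_ideal_iff by simp
  then show ?thesis unfolding principal_open_def Spec_def by blast
qed

lemma gamma_ideal_principal:
  assumes I: "gamma_ideal T \<Gamma> u I" and a: "a \<in> carrier T"
  shows "gamma_ideal T \<Gamma> u {p \<oplus> c \<otimes> a | p c. p \<in> I \<and> c \<in> carrier T}" (is "gamma_ideal _ _ _ ?J")
  unfolding gamma_ideal_iff
proof (intro conjI ballI subsetI)
  have I': "I \<subseteq> carrier T" "\<zero> \<in> I" "\<And>p q. p \<in> I \<Longrightarrow> q \<in> I \<Longrightarrow> p \<oplus> q \<in> I"
    "\<And>p q. p \<in> I \<Longrightarrow> q \<in> carrier T \<Longrightarrow> p \<otimes> q \<in> I" using I by (auto simp: gamma_ideal_iff)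
  show "x \<in> carrier T" if "x \<in> ?J" for x using that I' a by auto
  show "\<zero> \<in> ?J" using I' a by (intro CollectI exI[of _ \<zero>]) auto
  fix x assume x: "x \<in> ?J"
  then obtain p c where x': "x = p \<oplus> c \<otimes> a" "p \<in> I" "c \<in> carrier T" by blast
  have pc: "p \<in> carrier T" using x' I' by blast
  { fix y assume "y \<in> ?J"
    then obtain q d where y': "y = q \<oplus> d \<otimes> a" "q \<in> I" "d \<in> carrier T" by blast
    have qc: "q \<in> carrier T" using y' I' by blast
    have "x \<oplus> y = (p \<oplus> q) \<oplus> (c \<oplus> d) \<otimes> a"
      using x' y' pc qc a by (simp add: l_distr a_ac)
    then show "x \<oplus> y \<in> ?J" using x' y' I' by blast }
  { fix y assume y: "y \<in> carrier T"
    have "x \<otimes> y = p \<otimes> y \<oplus> (c \<otimes> y) \<otimes> a"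
      using x' y pc a by (simp add: l_distr r_distr m_ac)
    then show "x \<otimes> y \<in> ?J" using x' y I' by blast }
qed

lemma powers_closed: "f \<in> carrier T \<Longrightarrow> powers T f \<subseteq> carrier T"
  by (auto simp: powers_def)

lemma powers_submonoid: "f \<in> carrier T \<Longrightarrow> submonoid (powers T f) T"
proof
  assume f: "f \<in> carrier T"
  show "powers T f \<subseteq> carrier T" by (rule powers_closed[OF f])
  show "\<one> \<in> powers T f" unfolding powers_def by (rule range_eqI[of _ _ 0]) simp
  fix x y assume "x \<in> powers T f" "y \<in> powers T f"
  then obtain m n :: nat where "x = f [^] m" "y = f [^] n" by (auto simp: powers_def)
  then have "x \<otimes> y = f [^] (m + n)" using f by (simp add: nat_pow_mult)
  then show "x \<otimes> y \<in> powers T f" by (auto simp: powers_def)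
qed

lemma principal_open_subset_imp:
  assumes f: "f \<in> carrier T" and g: "g \<in> carrier T"
    and sub: "principal_open T \<Gamma> u g \<subseteq> principal_open T \<Gamma> u f"
  shows "\<exists>c\<in>carrier T. f \<otimes> c \<in> powers T g"
proof (rule ccontr)
  assume no: "\<not> ?thesis"
  define S where "S = powers T g"
  interpret S: submonoid S T unfolding S_def by (rule powers_submonoid[OF g])
  define \<A> where "\<A> = {I. gamma_ideal T \<Gamma> u I \<and> f \<in> I \<and> I \<inter> S = {}}"
  have zero: "gamma_ideal T \<Gamma> u {\<zero>}" by (auto simp: gamma_ideal_iff)
  define I0 where "I0 = {p \<oplus> c \<otimes> f | p c. p \<in> {\<zero>} \<and> c \<in> carrier T}"
  have "gamma_ideal T \<Gamma> u I0" unfolding I0_def by (rule gamma_ideal_principal[OF zero f])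
  moreover have "f \<in> I0" unfolding I0_def
    using f by (intro CollectI exI[of _ \<zero>] exI[of _ \<one>]) auto
  moreover have "I0 \<inter> S = {}" using no f unfolding I0_def S_def
    by (auto simp: m_comm)
  ultimately have ne: "\<A> \<noteq> {}" unfolding \<A>_def by blast
  have "\<Union>\<C> \<in> \<A>" if "\<C> \<noteq> {}" "subset.chain \<A> \<C>" for \<C>
  proof -
    have C: "\<And>I. I \<in> \<C> \<Longrightarrow> gamma_ideal T \<Gamma> u I \<and> f \<in> I \<and> I \<inter> S = {}"
      and ch: "\<And>I J. I \<in> \<C> \<Longrightarrow> J \<in> \<C> \<Longrightarrow> I \<subseteq> J \<or> J \<subseteq> I"
      using that unfolding subset_chain_def \<A>_def by auto
    have add: "a \<oplus> b \<in> \<Union>\<C>" if "a \<in> \<Union>\<C>" "b \<in> \<Union>\<C>" for a b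
    proof -
      obtain I J where "I \<in> \<C>" "J \<in> \<C>" "a \<in> I" "b \<in> J" using \<open>a \<in> \<Union>\<C>\<close> \<open>b \<in> \<Union>\<C>\<close> by blast
      then obtain K where "K \<in> \<C>" "a \<in> K" "b \<in> K" using ch by blast
      then show ?thesis using C[of K] unfolding gamma_ideal_iff by blast
    qed
    have "gamma_ideal T \<Gamma> u (\<Union>\<C>)" unfolding gamma_ideal_iff
    proof (intro conjI)
      show "\<Union>\<C> \<subseteq> carrier T" using C unfolding gamma_ideal_iff by blast
      show "\<zero> \<in> \<Union>\<C>" using C that(1) unfolding gamma_ideal_iff by blast
      show "\<forall>a\<in>\<Union>\<C>. \<forall>b\<in>\<Union>\<C>. a \<oplus> b \<in> \<Union>\<C>" using add by blast
      show "\<forall>a\<in>\<Union>\<C>. \<forall>b\<in>carrier T. a \<otimes> b \<in> \<Union>\<C>" using C unfolding gamma_ideal_iff by blast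
    qed
    then show ?thesis using C that(1) unfolding \<A>_def by blast
  qed
  then obtain P where P: "P \<in> \<A>" and max: "\<And>J. J \<in> \<A> \<Longrightarrow> P \<subseteq> J \<Longrightarrow> J = P"
    using subset_Zorn_nonempty[OF ne] by metis
  have PI: "gamma_ideal T \<Gamma> u P" and fP: "f \<in> P" and PS: "P \<inter> S = {}"
    using P by (auto simp: \<A>_def)
  have Pc: "P \<subseteq> carrier T" "\<zero> \<in> P" "\<And>p q. p \<in> P \<Longrightarrow> q \<in> P \<Longrightarrow> p \<oplus> q \<in> P"
    "\<And>p q. p \<in> P \<Longrightarrow> q \<in> carrier T \<Longrightarrow> p \<otimes> q \<in> P"
    using PI by (auto simp: gamma_ideal_iff)
  have hit: "\<exists>p\<in>P. \<exists>c\<in>carrier T. p \<oplus> c \<otimes> a \<in> S" if a: "a \<in> carrier T" "a \<notin> P" for a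
  proof (rule ccontr)
    assume "\<not> ?thesis"
    then have dis: "{p \<oplus> c \<otimes> a | p c. p \<in> P \<and> c \<in> carrier T} \<inter> S = {}" (is "?J \<inter> S = {}")
      by blast
    have PJ: "P \<subseteq> ?J"
    proof
      fix p assume p: "p \<in> P"
      then have "p = p \<oplus> \<zero> \<otimes> a" using a Pc by auto
      then show "p \<in> ?J" using p by blast
    qed
    have "a = \<zero> \<oplus> \<one> \<otimes> a" using a by simp
    then have "a \<in> ?J" using Pc(2) by blast
    moreover have "?J = P"
      using gamma_ideal_principal[OF PI a(1)] dis PJ fP by (intro max) (auto simp: \<A>_def)
    ultimately show False using a by blast
  qed
  have "prime_gamma_ideal T \<Gamma> u P" unfolding prime_gamma_ideal_iff
  proof (intro conjI ballI impI PI)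
    show "\<one> \<notin> P" using PS S.one_closed by blast
    fix a b assume ab: "a \<in> carrier T" "b \<in> carrier T" "a \<otimes> b \<in> P"
    show "a \<in> P \<or> b \<in> P"
    proof (rule ccontr)
      assume "\<not> ?thesis"
      then obtain p c q d where pc: "p \<in> P" "c \<in> carrier T" "p \<oplus> c \<otimes> a \<in> S"
        and qd: "q \<in> P" "d \<in> carrier T" "q \<oplus> d \<otimes> b \<in> S"
        using hit ab by meson
      have pq: "p \<in> carrier T" "q \<in> carrier T" using pc qd Pc by auto
      have "(p \<oplus> c \<otimes> a) \<otimes> (q \<oplus> d \<otimes> b)
          = (p \<otimes> (q \<oplus> d \<otimes> b) \<oplus> q \<otimes> (c \<otimes> a)) \<oplus> (a \<otimes> b) \<otimes> (c \<otimes> d)"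
        using pq pc(2) qd(2) ab by (simp add: l_distr r_distr m_ac a_ac)
      moreover have "\<dots> \<in> P"
      proof (intro Pc(3))
        show "p \<otimes> (q \<oplus> d \<otimes> b) \<in> P" by (rule Pc(4)) (use pq pc qd ab in auto)
        show "q \<otimes> (c \<otimes> a) \<in> P" by (rule Pc(4)) (use pq pc qd ab in auto)
        show "a \<otimes> b \<otimes> (c \<otimes> d) \<in> P" by (rule Pc(4)) (use pq pc qd ab in auto)
      qed
      ultimately show False using S.m_closed[OF pc(3) qd(3)] PS by auto
    qed
  qed
  moreover have "g \<notin> P"
  proof -
    have "g [^] (1::nat) \<in> S" unfolding S_def powers_def by blast
    then show ?thesis using PS g by auto
  qed
  ultimately show False using sub fP by (auto simp: principal_open_def Spec_def)
qed

end

locale localization_at = comm_semiring + submonoid S R for S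
begin

abbreviation "fr \<equiv> fraction R S"
abbreviation "L \<equiv> localization R S"

lemma S_carrier: "s \<in> S \<Longrightarrow> s \<in> carrier R"
  using subset by blast

lemma equiv_frac_rel: "equiv (carrier R \<times> S) (frac_rel R S)"
proof (rule equivI)
  show "frac_rel R S \<subseteq> (carrier R \<times> S) \<times> (carrier R \<times> S)" by (auto simp: frac_rel_def)
  show "refl_on (carrier R \<times> S) (frac_rel R S)"
    using submonoid.one_closed[OF is_submonoid] by (auto simp: frac_rel_def refl_on_def)
  show "sym (frac_rel R S)" by (auto simp: frac_rel_def sym_def) metis
  show "trans (frac_rel R S)"
  proof (rule transI, clarify)
    fix a s b t c r
    assume 1: "((a, s), (b, t)) \<in> frac_rel R S" and 2: "((b, t), (c, r)) \<in> frac_rel R S"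
    then obtain w v where w: "w \<in> S" "w \<otimes> a \<otimes> t = w \<otimes> b \<otimes> s"
      and v: "v \<in> S" "v \<otimes> b \<otimes> r = v \<otimes> c \<otimes> t" by (auto simp: frac_rel_def)
    have m: "a \<in> carrier R" "b \<in> carrier R" "c \<in> carrier R" "s \<in> S" "t \<in> S" "r \<in> S"
      using 1 2 by (auto simp: frac_rel_def)
    note c = m(1-3) m(4-6)[THEN S_carrier] w(1)[THEN S_carrier] v(1)[THEN S_carrier]
    have "(w \<otimes> v \<otimes> t) \<otimes> a \<otimes> r = (w \<otimes> a \<otimes> t) \<otimes> (v \<otimes> r)" using c by (simp add: m_ac)
    also have "\<dots> = (v \<otimes> b \<otimes> r) \<otimes> (w \<otimes> s)" unfolding w using c by (simp add: m_ac)
    also have "\<dots> = (w \<otimes> v \<otimes> t) \<otimes> c \<otimes> s" unfolding v using c by (simp add: m_ac)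
    finally show "((a, s), (c, r)) \<in> frac_rel R S"
      using m w v by (auto simp: frac_rel_def)
  qed
qed

lemma frac_eq_iff:
  assumes "a \<in> carrier R" "s \<in> S" "b \<in> carrier R" "t \<in> S"
  shows "fr a s = fr b t \<longleftrightarrow> (\<exists>w\<in>S. w \<otimes> a \<otimes> t = w \<otimes> b \<otimes> s)"
proof -
  have "fr a s = fr b t \<longleftrightarrow> ((a, s), (b, t)) \<in> frac_rel R S"
    unfolding fraction_def using assms by (intro eq_equiv_class_iff[OF equiv_frac_rel]) auto
  then show ?thesis using assms by (auto simp: frac_rel_def)
qed

lemma frac_in: "a \<in> carrier R \<Longrightarrow> s \<in> S \<Longrightarrow> fr a s \<in> carrier L"
  by (auto simp: localization_def fraction_def intro: quotientI)

lemma fracE: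
  assumes "X \<in> carrier L"
  obtains a s where "a \<in> carrier R" "s \<in> S" "X = fr a s"
  using assms by (auto simp: localization_def fraction_def elim!: quotientE)

lemma frac_memD:
  assumes "(a', s') \<in> fr a s"
  shows "a \<in> carrier R" "s \<in> S" "a' \<in> carrier R" "s' \<in> S" "\<exists>w\<in>S. w \<otimes> a \<otimes> s' = w \<otimes> a' \<otimes> s"
  using assms by (auto simp: fraction_def frac_rel_def)

lemma frac_mem: "a \<in> carrier R \<Longrightarrow> s \<in> S \<Longrightarrow> (a, s) \<in> fr a s"
  using equiv_class_self[OF equiv_frac_rel] by (auto simp: fraction_def)

lemma frac_mult:
  assumes "a \<in> carrier R" "s \<in> S" "b \<in> carrier R" "t \<in> S"
  shows "fr a s \<otimes>\<^bsub>L\<^esub> fr b t = fr (a \<otimes> b) (s \<otimes> t)"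
proof -
  have "fr (a' \<otimes> b') (s' \<otimes> t') = fr (a \<otimes> b) (s \<otimes> t)"
    if 1: "(a', s') \<in> fr a s" and 2: "(b', t') \<in> fr b t" for a' s' b' t'
  proof -
    note m = frac_memD(3,4)[OF 1] frac_memD(3,4)[OF 2]
    obtain w v where w: "w \<in> S" "w \<otimes> a \<otimes> s' = w \<otimes> a' \<otimes> s"
      and v: "v \<in> S" "v \<otimes> b \<otimes> t' = v \<otimes> b' \<otimes> t"
      using frac_memD(5)[OF 1] frac_memD(5)[OF 2] by blast
    note c = assms(1,3) assms(2,4)[THEN S_carrier] m(1,3) m(2,4)[THEN S_carrier]
      w(1)[THEN S_carrier] v(1)[THEN S_carrier]
    have "(w \<otimes> v) \<otimes> (a' \<otimes> b') \<otimes> (s \<otimes> t) = (w \<otimes> a' \<otimes> s) \<otimes> (v \<otimes> b' \<otimes> t)"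
      using c by (simp add: m_ac)
    also have "\<dots> = (w \<otimes> v) \<otimes> (a \<otimes> b) \<otimes> (s' \<otimes> t')"
      unfolding w(2)[symmetric] v(2)[symmetric] using c by (simp add: m_ac)
    finally show ?thesis
      using assms m w(1) v(1) by (subst frac_eq_iff) auto
  qed
  then have "(\<Union>(a', s')\<in>fr a s. \<Union>(b', t')\<in>fr b t. fr (a' \<otimes> b') (s' \<otimes> t')) = fr (a \<otimes> b) (s \<otimes> t)"
    using frac_mem[OF assms(1,2)] frac_mem[OF assms(3,4)] by fast
  then show ?thesis by (simp add: localization_def)
qed

lemma frac_add:
  assumes "a \<in> carrier R" "s \<in> S" "b \<in> carrier R" "t \<in> S"
  shows "fr a s \<oplus>\<^bsub>L\<^esub> fr b t = fr (a \<otimes> t \<oplus> b \<otimes> s) (s \<otimes> t)"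
proof -
  have "fr (a' \<otimes> t' \<oplus> b' \<otimes> s') (s' \<otimes> t') = fr (a \<otimes> t \<oplus> b \<otimes> s) (s \<otimes> t)"
    if 1: "(a', s') \<in> fr a s" and 2: "(b', t') \<in> fr b t" for a' s' b' t'
  proof -
    note m = frac_memD(3,4)[OF 1] frac_memD(3,4)[OF 2]
    obtain w v where w: "w \<in> S" "w \<otimes> a \<otimes> s' = w \<otimes> a' \<otimes> s"
      and v: "v \<in> S" "v \<otimes> b \<otimes> t' = v \<otimes> b' \<otimes> t"
      using frac_memD(5)[OF 1] frac_memD(5)[OF 2] by blast
    note c = assms(1,3) assms(2,4)[THEN S_carrier] m(1,3) m(2,4)[THEN S_carrier]
      w(1)[THEN S_carrier] v(1)[THEN S_carrier]
    have "(w \<otimes> v) \<otimes> (a' \<otimes> t' \<oplus> b' \<otimes> s') \<otimes> (s \<otimes> t)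
        = (w \<otimes> a' \<otimes> s) \<otimes> (v \<otimes> t' \<otimes> t) \<oplus> (v \<otimes> b' \<otimes> t) \<otimes> (w \<otimes> s' \<otimes> s)"
      using c by (simp add: m_ac l_distr r_distr)
    also have "\<dots> = (w \<otimes> v) \<otimes> (a \<otimes> t \<oplus> b \<otimes> s) \<otimes> (s' \<otimes> t')"
      unfolding w(2)[symmetric] v(2)[symmetric] using c by (simp add: m_ac l_distr r_distr)
    finally show ?thesis
      using assms m w(1) v(1) c by (subst frac_eq_iff) auto
  qed
  then have "(\<Union>(a', s')\<in>fr a s. \<Union>(b', t')\<in>fr b t. fr (a' \<otimes> t' \<oplus> b' \<otimes> s') (s' \<otimes> t'))
      = fr (a \<otimes> t \<oplus> b \<otimes> s) (s \<otimes> t)"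
    using frac_mem[OF assms(1,2)] frac_mem[OF assms(3,4)] by fast
  then show ?thesis by (simp add: localization_def)
qed

lemma frac_one: "\<one>\<^bsub>L\<^esub> = fr \<one> \<one>" and frac_zero: "\<zero>\<^bsub>L\<^esub> = fr \<zero> \<one>"
  by (simp_all add: localization_def)

lemma frac_eqI:
  "\<lbrakk>a \<in> carrier R; s \<in> S; b \<in> carrier R; t \<in> S; a \<otimes> t = b \<otimes> s\<rbrakk> \<Longrightarrow> fr a s = fr b t"
  using submonoid.one_closed[OF is_submonoid] S_carrier
  by (subst frac_eq_iff) (auto intro!: bexI[of _ \<one>])

lemma one_S: "\<one> \<in> S" using submonoid.one_closed[OF is_submonoid] .
lemma mult_S: "s \<in> S \<Longrightarrow> t \<in> S \<Longrightarrow> s \<otimes> t \<in> S" using submonoid.m_closed[OF is_submonoid] .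

lemma comm_semiring_localization: "comm_semiring L"
proof -
  note [simp] = S_carrier one_S mult_S frac_in frac_mult frac_add frac_one frac_zero
  have "comm_monoid L"
    by (rule comm_monoidI) (auto elim!: fracE simp: m_ac)
  moreover have "abelian_monoid L"
    by (rule abelian_monoidI) (auto elim!: fracE simp: m_ac l_distr r_distr a_ac)
  moreover have "semiring_axioms L"
  proof (rule semiring_axioms.intro)
    fix x y z assume "x \<in> carrier L" "y \<in> carrier L" "z \<in> carrier L"
    then obtain a s b t c r where m: "a \<in> carrier R" "s \<in> S" "x = fr a s" "b \<in> carrier R" "t \<in> S"
      "y = fr b t" "c \<in> carrier R" "r \<in> S" "z = fr c r" by (metis fracE)
    show "(x \<oplus>\<^bsub>L\<^esub> y) \<otimes>\<^bsub>L\<^esub> z = x \<otimes>\<^bsub>L\<^esub> z \<oplus>\<^bsub>L\<^esub> y \<otimes>\<^bsub>L\<^esub> z"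
      using m by (simp, intro frac_eqI) (simp_all add: m_ac l_distr r_distr)
    show "z \<otimes>\<^bsub>L\<^esub> (x \<oplus>\<^bsub>L\<^esub> y) = z \<otimes>\<^bsub>L\<^esub> x \<oplus>\<^bsub>L\<^esub> z \<otimes>\<^bsub>L\<^esub> y"
      using m by (simp, intro frac_eqI) (simp_all add: m_ac l_distr r_distr)
  next
    fix x assume "x \<in> carrier L"
    then obtain a s where m: "a \<in> carrier R" "s \<in> S" "x = fr a s" by (metis fracE)
    show "\<zero>\<^bsub>L\<^esub> \<otimes>\<^bsub>L\<^esub> x = \<zero>\<^bsub>L\<^esub>" "x \<otimes>\<^bsub>L\<^esub> \<zero>\<^bsub>L\<^esub> = \<zero>\<^bsub>L\<^esub>"
      using m by (simp, intro frac_eqI, simp_all)+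
  qed
  ultimately show ?thesis
    by (simp add: comm_semiring_def semiring_def comm_monoid_def)
qed

end

lemma localization_hom_ex1:
  assumes "localization_at R S" "localization_at R S'"
    and inv: "\<And>s. s \<in> S \<Longrightarrow> \<exists>s'\<in>carrier R. s \<otimes>\<^bsub>R\<^esub> s' \<in> S'"
  shows "\<exists>!h. h \<in> semiring_hom (localization R S) (localization R S') \<and>
    h \<in> extensional (carrier (localization R S)) \<and>
    (\<forall>a\<in>carrier R. h (fraction R S a \<one>\<^bsub>R\<^esub>) = fraction R S' a \<one>\<^bsub>R\<^esub>)"
proof -
  interpret A: localization_at R S by fact
  interpret B: localization_at R S' by fact
  note cs = A.S_carrier B.S_carrier
  define j where "j s = (SOME s'. s' \<in> carrier R \<and> s \<otimes>\<^bsub>R\<^esub> s' \<in> S')" for s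
  have j: "j s \<in> carrier R" "s \<otimes>\<^bsub>R\<^esub> j s \<in> S'" if "s \<in> S" for s
    using someI_ex[of "\<lambda>s'. s' \<in> carrier R \<and> s \<otimes>\<^bsub>R\<^esub> s' \<in> S'"] inv[OF that] unfolding j_def by auto
  define k where "k = (\<lambda>(a, s). B.fr (a \<otimes>\<^bsub>R\<^esub> j s) (s \<otimes>\<^bsub>R\<^esub> j s))"
  define h where "h = (\<lambda>X\<in>carrier A.L. k (SOME p. p \<in> X))"
  have key: "B.fr (a \<otimes>\<^bsub>R\<^esub> a') (s \<otimes>\<^bsub>R\<^esub> a') = B.fr (b \<otimes>\<^bsub>R\<^esub> b') (t \<otimes>\<^bsub>R\<^esub> b')"
    if e: "A.fr a s = A.fr b t" and m: "a \<in> carrier R" "s \<in> S" "b \<in> carrier R" "t \<in> S"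
      "a' \<in> carrier R" "b' \<in> carrier R" "s \<otimes>\<^bsub>R\<^esub> a' \<in> S'" "t \<otimes>\<^bsub>R\<^esub> b' \<in> S'" for a s b t a' b'
  proof -
    obtain w where w: "w \<in> S" "w \<otimes>\<^bsub>R\<^esub> a \<otimes>\<^bsub>R\<^esub> t = w \<otimes>\<^bsub>R\<^esub> b \<otimes>\<^bsub>R\<^esub> s"
      using e m by (auto simp: A.frac_eq_iff)
    note c = m(1,3,5,6) m(2,4)[THEN A.S_carrier] w(1)[THEN A.S_carrier] j(1)[OF w(1)]
    have "(w \<otimes>\<^bsub>R\<^esub> j w) \<otimes>\<^bsub>R\<^esub> (a \<otimes>\<^bsub>R\<^esub> a') \<otimes>\<^bsub>R\<^esub> (t \<otimes>\<^bsub>R\<^esub> b')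
        = (w \<otimes>\<^bsub>R\<^esub> a \<otimes>\<^bsub>R\<^esub> t) \<otimes>\<^bsub>R\<^esub> (j w \<otimes>\<^bsub>R\<^esub> a' \<otimes>\<^bsub>R\<^esub> b')"
      using c by (simp add: A.m_ac)
    also have "\<dots> = (w \<otimes>\<^bsub>R\<^esub> j w) \<otimes>\<^bsub>R\<^esub> (b \<otimes>\<^bsub>R\<^esub> b') \<otimes>\<^bsub>R\<^esub> (s \<otimes>\<^bsub>R\<^esub> a')"
      unfolding w(2) using c by (simp add: A.m_ac)
    finally show ?thesis
      using c m j(2)[OF w(1)] by (subst B.frac_eq_iff) auto
  qed
  have h: "h (A.fr a s) = B.fr (a \<otimes>\<^bsub>R\<^esub> a') (s \<otimes>\<^bsub>R\<^esub> a')"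
    if m: "a \<in> carrier R" "s \<in> S" "a' \<in> carrier R" "s \<otimes>\<^bsub>R\<^esub> a' \<in> S'" for a s a'
  proof -
    obtain b t where bt: "(SOME p. p \<in> A.fr a s) = (b, t)" by fastforce
    have "(b, t) \<in> A.fr a s"
      using someI[of "\<lambda>p. p \<in> A.fr a s", OF A.frac_mem[OF m(1,2)]] bt by simp
    note d = A.frac_memD(3-5)[OF this]
    have "A.fr b t = A.fr a s" using d m by (simp add: A.frac_eq_iff) metis
    then show ?thesis
      using key[of b t a s "j t" a'] m bt d j[of t] A.frac_in[OF m(1,2)]
      by (simp add: h_def k_def)
  qed
  have h1: "h (A.fr a \<one>\<^bsub>R\<^esub>) = B.fr a \<one>\<^bsub>R\<^esub>" if "a \<in> carrier R" for a
    using h[OF that A.one_S A.S_carrier[OF A.one_S]] that B.one_S by simp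
  have hom: "h \<in> semiring_hom A.L B.L"
  proof -
    have cl: "h X \<in> carrier B.L" if X: "X \<in> carrier A.L" for X
    proof -
      obtain a s where X: "a \<in> carrier R" "s \<in> S" "X = A.fr a s" by (rule A.fracE[OF X])
      show ?thesis unfolding X(3) h[OF X(1,2) j[OF X(2)]]
        using X j[OF X(2)] by (intro B.frac_in) auto
    qed
    have mu: "h (X \<otimes>\<^bsub>A.L\<^esub> Y) = h X \<otimes>\<^bsub>B.L\<^esub> h Y \<and> h (X \<oplus>\<^bsub>A.L\<^esub> Y) = h X \<oplus>\<^bsub>B.L\<^esub> h Y"
      if XY: "X \<in> carrier A.L" "Y \<in> carrier A.L" for X Y
    proof -
      obtain a s where X: "a \<in> carrier R" "s \<in> S" "X = A.fr a s" by (rule A.fracE[OF XY(1)])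
      obtain b t where Y: "b \<in> carrier R" "t \<in> S" "Y = A.fr b t" by (rule A.fracE[OF XY(2)])
      note c = X(1) Y(1) A.S_carrier[OF X(2)] A.S_carrier[OF Y(2)] j(1)[OF X(2)] j(1)[OF Y(2)]
      have e: "(s \<otimes>\<^bsub>R\<^esub> t) \<otimes>\<^bsub>R\<^esub> (j s \<otimes>\<^bsub>R\<^esub> j t) = (s \<otimes>\<^bsub>R\<^esub> j s) \<otimes>\<^bsub>R\<^esub> (t \<otimes>\<^bsub>R\<^esub> j t)"
        using c by (simp add: A.m_ac)
      have S': "(s \<otimes>\<^bsub>R\<^esub> t) \<otimes>\<^bsub>R\<^esub> (j s \<otimes>\<^bsub>R\<^esub> j t) \<in> S'"
        unfolding e by (intro B.mult_S j X Y)
      have st: "s \<otimes>\<^bsub>R\<^esub> t \<in> S" by (intro A.mult_S X Y)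
      have jj: "j s \<otimes>\<^bsub>R\<^esub> j t \<in> carrier R" using c by simp
      note hX = h[OF X(1,2) j[OF X(2)]] and hY = h[OF Y(1,2) j[OF Y(2)]]
      have "h (X \<otimes>\<^bsub>A.L\<^esub> Y)
          = B.fr ((a \<otimes>\<^bsub>R\<^esub> b) \<otimes>\<^bsub>R\<^esub> (j s \<otimes>\<^bsub>R\<^esub> j t)) ((s \<otimes>\<^bsub>R\<^esub> t) \<otimes>\<^bsub>R\<^esub> (j s \<otimes>\<^bsub>R\<^esub> j t))"
        unfolding X(3) Y(3) A.frac_mult[OF X(1,2) Y(1,2)]
        by (rule h) (use c st S' in auto)
      also have "\<dots> = h X \<otimes>\<^bsub>B.L\<^esub> h Y"
        unfolding X(3) Y(3) hX hY using c j(2)[OF X(2)] j(2)[OF Y(2)]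
        by (subst B.frac_mult) (simp_all add: A.m_ac)
      finally have 1: "h (X \<otimes>\<^bsub>A.L\<^esub> Y) = h X \<otimes>\<^bsub>B.L\<^esub> h Y" .
      have "h (X \<oplus>\<^bsub>A.L\<^esub> Y)
          = B.fr ((a \<otimes>\<^bsub>R\<^esub> t \<oplus>\<^bsub>R\<^esub> b \<otimes>\<^bsub>R\<^esub> s) \<otimes>\<^bsub>R\<^esub> (j s \<otimes>\<^bsub>R\<^esub> j t)) ((s \<otimes>\<^bsub>R\<^esub> t) \<otimes>\<^bsub>R\<^esub> (j s \<otimes>\<^bsub>R\<^esub> j t))"
        unfolding X(3) Y(3) A.frac_add[OF X(1,2) Y(1,2)]
        by (rule h) (use c st S' in auto)
      also have "\<dots> = h X \<oplus>\<^bsub>B.L\<^esub> h Y"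
        unfolding X(3) Y(3) hX hY using c j(2)[OF X(2)] j(2)[OF Y(2)]
        by (subst B.frac_add) (simp_all add: A.m_ac A.l_distr A.r_distr)
      finally show ?thesis using 1 by simp
    qed
    show ?thesis unfolding semiring_hom_def
      using cl mu h1 by (auto simp: ring_hom_def A.frac_one B.frac_one A.frac_zero B.frac_zero)
  qed
  have uniq: "h' X = h X"
    if h': "h' \<in> semiring_hom A.L B.L" "\<forall>a\<in>carrier R. h' (A.fr a \<one>\<^bsub>R\<^esub>) = B.fr a \<one>\<^bsub>R\<^esub>"
      and XL: "X \<in> carrier A.L" for h' X
  proof -
    interpret LB: comm_semiring B.L by (rule B.comm_semiring_localization)
    obtain a s where X: "a \<in> carrier R" "s \<in> S" "X = A.fr a s" by (rule A.fracE[OF XL])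
    note c = X(1) A.S_carrier[OF X(2)] j(1)[OF X(2)] B.S_carrier[OF j(2)[OF X(2)]]
    define e where "e = B.fr (j s) (s \<otimes>\<^bsub>R\<^esub> j s)"
    have eL: "e \<in> carrier B.L" unfolding e_def using j[OF X(2)] by (intro B.frac_in)
    have sL: "B.fr s \<one>\<^bsub>R\<^esub> \<in> carrier B.L" using c B.one_S by (intro B.frac_in)
    have inv: "B.fr s \<one>\<^bsub>R\<^esub> \<otimes>\<^bsub>B.L\<^esub> e = \<one>\<^bsub>B.L\<^esub>"
      unfolding e_def B.frac_one using c j[OF X(2)] B.one_S
      by (subst B.frac_mult, simp_all, intro B.frac_eqI, simp_all)
    have g: "g X = B.fr a \<one>\<^bsub>R\<^esub> \<otimes>\<^bsub>B.L\<^esub> e"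
      if g: "g \<in> semiring_hom A.L B.L" "\<forall>a\<in>carrier R. g (A.fr a \<one>\<^bsub>R\<^esub>) = B.fr a \<one>\<^bsub>R\<^esub>" for g
    proof -
      have gr: "g \<in> ring_hom A.L B.L" using g by (simp add: semiring_hom_def)
      have s1: "A.fr s \<one>\<^bsub>R\<^esub> \<in> carrier A.L" using c A.one_S by (intro A.frac_in)
      have "X \<otimes>\<^bsub>A.L\<^esub> A.fr s \<one>\<^bsub>R\<^esub> = A.fr a \<one>\<^bsub>R\<^esub>" unfolding X(3)
        using c X A.one_S by (subst A.frac_mult, simp_all, intro A.frac_eqI, simp_all)
      then have "g X \<otimes>\<^bsub>B.L\<^esub> B.fr s \<one>\<^bsub>R\<^esub> = B.fr a \<one>\<^bsub>R\<^esub>"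
        using ring_hom_mult[OF gr XL s1] g c by simp
      moreover have "g X \<in> carrier B.L" by (rule ring_hom_closed[OF gr XL])
      ultimately show ?thesis using inv sL eL
        by (metis LB.m_assoc LB.r_one)
    qed
    show ?thesis using g[OF h'] g[OF hom] h1 by simp
  qed
  have ext: "h \<in> extensional (carrier A.L)" unfolding h_def by simp
  show ?thesis
  proof (rule ex1I[of _ h])
    show "h \<in> semiring_hom A.L B.L \<and> h \<in> extensional (carrier A.L) \<and>
        (\<forall>a\<in>carrier R. h (A.fr a \<one>\<^bsub>R\<^esub>) = B.fr a \<one>\<^bsub>R\<^esub>)"
      using hom ext h1 by blast
    fix h' assume "h' \<in> semiring_hom A.L B.L \<and> h' \<in> extensional (carrier A.L) \<and>
        (\<forall>a\<in>carrier R. h' (A.fr a \<one>\<^bsub>R\<^esub>) = B.fr a \<one>\<^bsub>R\<^esub>)"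
    then show "h' = h" using uniq ext by (blast intro: extensionalityI)
  qed
qed

context ternary_gamma_semiring
begin

lemma localization_at_powers: "f \<in> carrier T \<Longrightarrow> localization_at T (powers T f)"
  by (intro localization_at.intro comm_semiring_axioms powers_submonoid)

lemma loc_restriction_ex1:
  assumes f: "f \<in> carrier T" and g: "g \<in> carrier T"
    and sub: "principal_open T \<Gamma> u g \<subseteq> principal_open T \<Gamma> u f"
  shows "\<exists>!h. h \<in> semiring_hom (loc_at T f) (loc_at T g) \<and> h \<in> extensional (carrier (loc_at T f)) \<and>
    (\<forall>a\<in>carrier T. h (to_loc_at T f a) = to_loc_at T g a)"
  unfolding loc_at_def to_loc_at_def
proof (rule localization_hom_ex1)
  show "localization_at T (powers T f)" "localization_at T (powers T g)"
    using f g by (auto intro: localization_at_powers)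
  interpret S: submonoid "powers T g" T by (rule powers_submonoid[OF g])
  obtain c where c: "c \<in> carrier T" "f \<otimes> c \<in> powers T g"
    using principal_open_subset_imp[OF f g sub] by blast
  fix s assume "s \<in> powers T f"
  then obtain n :: nat where n: "s = f [^] n" by (auto simp: powers_def)
  have "(f \<otimes> c) [^] k \<in> powers T g" for k :: nat
    by (induction k) (use c S.m_closed S.one_closed in auto)
  then have "s \<otimes> c [^] n \<in> powers T g" unfolding n using f c by (simp add: nat_pow_distrib)
  then show "\<exists>s'\<in>carrier T. s \<otimes> s' \<in> powers T g" using c by (intro bexI[of _ "c [^] n"]) auto
qed

end

end

theory Submission
  imports Defs
begin

text \<open>
  The identity is commutative algebra over an idempotent semiring. In a commutative semiring
  all four nested brackets in the identity have the same five factors and two copies of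
  \<open>u\<^sub>\<gamma>\<close>, whichever slot the inner bracket occupies, so each of them is
  \<open>x\<^sub>1 x\<^sub>2 y\<^sub>1 y\<^sub>2 y\<^sub>3 u\<^sub>\<gamma>\<^sup>2\<close>. The identity then reads \<open>p = p + p + p\<close>, which
  idempotence gives (\<open>triadic_idempotent_Filippov\<close>).

  What remains is that sections over an arbitrary open \<open>U\<close> are idempotent. This can be seen on
  global sections alone, because idempotence of a semiring is the single equation \<open>1 + 1 = 1\<close>
  (multiply by \<open>x\<close>), and an equation between constants passes along every semiring homomorphism.
  It passes from \<open>T\<close> to \<open>T\<^sub>1\<close>, is reflected along the isomorphism of the global sections with
  \<open>T\<^sub>1\<close>, and is carried by restriction from the whole spectrum to \<open>U\<close> (\<open>idempotent_sections\<close>).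
\<close>

lemma (in comm_semiring) idempotent_semiring_iff_one:
  "idempotent_semiring R \<longleftrightarrow> \<one> \<oplus> \<one> = \<one>"
proof
  assume "idempotent_semiring R"
  then show "\<one> \<oplus> \<one> = \<one>" by (simp add: idempotent_semiring_def)
next
  assume one: "\<one> \<oplus> \<one> = \<one>"
  have "x \<oplus> x = x" if "x \<in> carrier R" for x
    using l_distr[OF one_closed one_closed that] that by (simp add: one)
  then show "idempotent_semiring R" by (simp add: idempotent_semiring_def)
qed

text \<open>A restriction map of the sheaf may have a small image, so that idempotence of its values says
  nothing about the other sections; the image does contain \<open>1\<close>, and \<open>1 + 1 = 1\<close> is enough.\<close>

lemma idempotent_semiring_hom:
  assumes "comm_semiring R" "comm_semiring S" "h \<in> semiring_hom R S" "idempotent_semiring R"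
  shows "idempotent_semiring S"
proof -
  interpret R: comm_semiring R by fact
  interpret S: comm_semiring S by fact
  have h: "h \<in> ring_hom R S" using assms(3) by (simp add: semiring_hom_def)
  have "h (\<one>\<^bsub>R\<^esub> \<oplus>\<^bsub>R\<^esub> \<one>\<^bsub>R\<^esub>) = h \<one>\<^bsub>R\<^esub>"
    using assms(4) by (simp add: R.idempotent_semiring_iff_one)
  then show ?thesis
    by (simp add: S.idempotent_semiring_iff_one ring_hom_add[OF h] ring_hom_one[OF h])
qed

lemma idempotent_semiring_reflected:
  assumes "comm_semiring R" "h \<in> semiring_iso R S" "idempotent_semiring S"
  shows "idempotent_semiring R"
proof -
  interpret R: comm_semiring R by fact
  have h: "h \<in> ring_hom R S" and inj: "inj_on h (carrier R)"
    using assms(2) by (auto simp: semiring_iso_def semiring_hom_def bij_betw_def)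
  have "h (x \<oplus>\<^bsub>R\<^esub> x) = h x" if "x \<in> carrier R" for x
    using assms(3) ring_hom_closed[OF h that]
    by (simp add: ring_hom_add[OF h that that] idempotent_semiring_def)
  then show ?thesis
    unfolding idempotent_semiring_def using inj by (meson R.add.m_closed inj_onD)
qed

lemma (in localization_at) idempotent_semiring_localization:
  assumes "idempotent_semiring R"
  shows "idempotent_semiring L"
proof -
  interpret L: comm_semiring L by (rule comm_semiring_localization)
  have "\<one>\<^bsub>L\<^esub> \<oplus>\<^bsub>L\<^esub> \<one>\<^bsub>L\<^esub> = \<one>\<^bsub>L\<^esub>"
    using assms by (simp add: frac_one frac_add one_S idempotent_semiring_iff_one)
  then show ?thesis by (simp add: L.idempotent_semiring_iff_one)
qed

lemma (in comm_semiring) triadic_idempotent_Filippov: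
  assumes "idempotent_semiring R" "v \<in> carrier R"
  shows "idempotent_Filippov_identity R (triadic R v)"
  unfolding idempotent_Filippov_identity_def
proof (intro ballI)
  fix x1 x2 y1 y2 y3
  assume c: "x1 \<in> carrier R" "x2 \<in> carrier R" "y1 \<in> carrier R" "y2 \<in> carrier R" "y3 \<in> carrier R"
  define p where "p = triadic R v x1 x2 (triadic R v y1 y2 y3)"
  have "p \<in> carrier R" using c assms(2) by (simp add: p_def triadic_def)
  then have "p = p \<oplus> p \<oplus> p" using assms(1) by (simp add: idempotent_semiring_def)
  moreover have "triadic R v (triadic R v x1 x2 y1) y2 y3 = p"
    "triadic R v y1 (triadic R v x1 x2 y2) y3 = p"
    "triadic R v y1 y2 (triadic R v x1 x2 y3) = p"
    using c assms(2) by (simp_all add: p_def triadic_def m_ac)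
  ultimately show "triadic R v x1 x2 (triadic R v y1 y2 y3) =
      triadic R v (triadic R v x1 x2 y1) y2 y3 \<oplus> triadic R v y1 (triadic R v x1 x2 y2) y3 \<oplus>
      triadic R v y1 y2 (triadic R v x1 x2 y3)"
    unfolding p_def[symmetric] by simp
qed

text \<open>The whole spectrum is the complement of the vanishing set of the unit ideal, which is empty
  because primes are proper.\<close>

lemma (in ternary_gamma_semiring) openin_Spec: "openin (spec_topology T \<Gamma> u) (Spec T \<Gamma> u)"
proof -
  have "gamma_ideal T \<Gamma> u (carrier T)" by (auto simp: gamma_ideal_iff)
  moreover have "vanishing T \<Gamma> u (carrier T) = {}"
    by (auto simp: vanishing_def Spec_def prime_gamma_ideal_def gamma_ideal_iff)
  ultimately show ?thesis unfolding openin_spec_topology by blast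
qed

lemma (in ternary_gamma_semiring) openin_subset_Spec:
  "openin (spec_topology T \<Gamma> u) U \<Longrightarrow> U \<subseteq> Spec T \<Gamma> u"
  unfolding openin_spec_topology by blast

context structure_sheaf
begin

text \<open>The identification of \<open>F (D(f))\<close> with \<open>T\<^sub>f\<close> reaches global sections through
  \<open>D(1) = Spec T\<close>.\<close>

lemma global_sections_iso: "\<phi> \<one> \<in> semiring_iso (F (Spec T \<Gamma> u)) (loc_at T \<one>)"
  using principal_iso[OF one_closed] by (simp add: principal_open_one)

lemma restr_global_hom:
  "openin (spec_topology T \<Gamma> u) U \<Longrightarrow>
    \<rho> (Spec T \<Gamma> u) U \<in> semiring_hom (F (Spec T \<Gamma> u)) (F U)"
  by (intro restr_hom openin_Spec openin_subset_Spec)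

lemma idempotent_sections:
  assumes "idempotent_semiring T" "openin (spec_topology T \<Gamma> u) U"
  shows "idempotent_semiring (F U)"
proof -
  interpret T1: localization_at T "powers T \<one>"
    by (rule localization_at_powers[OF one_closed])
  have "idempotent_semiring (loc_at T \<one>)"
    unfolding loc_at_def by (rule T1.idempotent_semiring_localization[OF assms(1)])
  then have "idempotent_semiring (F (Spec T \<Gamma> u))"
    by (rule idempotent_semiring_reflected[OF sections[OF openin_Spec] global_sections_iso])
  then show ?thesis
    by (rule idempotent_semiring_hom[OF sections[OF openin_Spec] sections[OF assms(2)]
          restr_global_hom[OF assms(2)]])
qed

lemma induced_section_closed:
  assumes "openin (spec_topology T \<Gamma> u) U" "a \<in> carrier T"
  shows "induced_section T \<Gamma> u F \<rho> \<phi> U a \<in> carrier (F U)"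
proof -
  interpret T1: localization_at T "powers T \<one>"
    by (rule localization_at_powers[OF one_closed])
  have "to_loc_at T \<one> a \<in> carrier (loc_at T \<one>)"
    unfolding to_loc_at_def loc_at_def by (rule T1.frac_in[OF assms(2) T1.one_S])
  then have "the_inv_into (carrier (F (Spec T \<Gamma> u))) (\<phi> \<one>) (to_loc_at T \<one> a)
      \<in> carrier (F (Spec T \<Gamma> u))"
    using global_sections_iso
    by (intro the_inv_into_into) (auto simp: semiring_iso_def bij_betw_def)
  moreover have "\<rho> (Spec T \<Gamma> u) U \<in> ring_hom (F (Spec T \<Gamma> u)) (F U)"
    using restr_global_hom[OF assms(1)] by (simp add: semiring_hom_def)
  ultimately show ?thesis
    unfolding induced_section_def by (rule ring_hom_closed[rotated])
qed

end

theorem theorem5: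
  fixes T :: "('a, 'm) ring_scheme" and \<Gamma> :: "('g, 'n) monoid_scheme" and u :: "'g \<Rightarrow> 'a"
    and \<O> :: "'a set set \<Rightarrow> 'b ring"
    and \<rho> :: "'a set set \<Rightarrow> 'a set set \<Rightarrow> 'b \<Rightarrow> 'b"
    and \<phi> :: "'a \<Rightarrow> 'b \<Rightarrow> ('a \<times> 'a) set"
  assumes "ternary_gamma_semiring T \<Gamma> u"
    and "idempotent_semiring T"
    and "structure_sheaf T \<Gamma> u \<O> \<rho> \<phi>"
    and "openin (spec_topology T \<Gamma> u) U"
    and "\<gamma> \<in> carrier \<Gamma>"
  shows "idempotent_Filippov_identity (\<O> U)
           (triadic (\<O> U) (induced_section T \<Gamma> u \<O> \<rho> \<phi> U (u \<gamma>)))"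
proof -
  interpret structure_sheaf T \<Gamma> u \<O> \<rho> \<phi> by fact
  show ?thesis
    by (intro comm_semiring.triadic_idempotent_Filippov sections idempotent_sections
        induced_section_closed u_carrier assms)
qed

end
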